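(* Let $H(t)=\tilde h(t)g(t)$ with $g(t)=e^{t\tilde A}$, and let $\tilde Y(t)=H(t)\tilde X(t)+\tilde C(t)$ be a dual Lorentzian homothetic exponential motion in $\mathbb{D}_1^3$, where $\tilde X(t)$ is the (smoothly varying) position vector of a point in the moving space. Let $n\ge 1$ and $\tilde C^{(n)}\neq 0$. Then $$\tilde Y^{(n)}=\sum_{k=0}^{n}\binom{n}{k}H^{(n-k)}\tilde X^{(k)}+\tilde C^{(n)},$$ or, equivalently, $$\tilde Y^{(n)}=\sum_{k=0}^{n}\binom{n}{k}\left[\sum_{i=0}^{n-k}\binom{n-k}{i}\tilde h^{(n-k-i)}\tilde A^{i}\right]g\,\tilde X^{(k)}+\tilde C^{(n)}.$$
   Context: Dual numbers: $\mathbb{D}=\{a+\mathcal{E}a^*: a,a^*\in\mathbb{R}\}$ with $\mathcal{E}^2=0$. $\mathbb{D}_1^3$ is the module $\mathbb{D}^3$ with the Lorentzian inner product obtained by extending $\langle a,b\rangle=a_1b_1+a_2b_2-a_3b_3$ bilinearly over $\mathbb{D}$. Let $\varepsilon=\mathrm{diag}(1,1,-1)$. A dual $3\times3$ matrix $\tilde A$ is (Lorentzian) anti-symmetric if $\tilde A=-\varepsilon\tilde A^T\varepsilon$; a dual matrix $g$ is (Lorentzian) orthogonal if $g^{-1}=\varepsilon g^T\varepsilon$. A dual Lorentzian homothetic exponential motion (of a moving space $K_0$ relative to a fixed space $K$) is given by $\tilde Y=H\tilde X+\tilde C$ with $H(t)=\tilde h(t)g(t)$, $g(t)=e^{t\tilde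 A}=\sum_{k\ge0}\frac{t^k}{k!}\tilde A^k$, where $t$ is a real parameter, $\tilde A$ is a constant dual Lorentzian anti-symmetric $3\times3$ matrix, $\tilde h(t)$ is a non-constant invertible dual-number-valued $C^\infty$ function (identified with the scalar matrix $\tilde h I_3$), and $\tilde C(t)\in\mathbb{D}^3$ is a $C^\infty$ column with $\tilde C'\neq0$. $\tilde X$, $\tilde Y$ are the position vectors (columns) of the same point in $K_0$ and $K$. A prime, and a superscript $(k)$, denote derivatives with respect to $t$; $\tilde A^0=I_3$. *)

theory Defs
  imports "HOL-Analysis.Analysis"
begin

section \<open>Dual numbers\<close>

datatype dualnum = Dual (re: real) (du: real)

lemma dualnum_eq_iff: "x = y \<longleftrightarrow> re x = re y \<and> du x = du y"
  by (cases x; cases y) simp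

instantiation dualnum :: comm_ring_1
begin

definition "0 = Dual 0 0"
definition "1 = Dual 1 0"
definition "x + y = Dual (re x + re y) (du x + du y)"
definition "- x = Dual (- re x) (- du x)"
definition "x - y = Dual (re x - re y) (du x - du y)"
definition "x * y = Dual (re x * re y) (re x * du y + du x * re y)"

instance
  by standard
    (simp_all add: dualnum_eq_iff zero_dualnum_def one_dualnum_def plus_dualnum_def
      uminus_dualnum_def minus_dualnum_def times_dualnum_def algebra_simps)

end

lemma re_du_simps [simp]:
  "re 0 = 0" "du 0 = 0" "re 1 = 1" "du 1 = 0"
  "re (x + y) = re x + re y" "du (x + y) = du x + du y"
  "re (- x) = - re x" "du (- x) = - du x"
  "re (x - y) = re x - re y" "du (x - y) = du x - du y"
  "re (x * y) = re x * re y" "du (x * y) = re x * du y + du x * re y"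
  by (simp_all add: zero_dualnum_def one_dualnum_def plus_dualnum_def
      uminus_dualnum_def minus_dualnum_def times_dualnum_def)

instantiation dualnum :: real_algebra_1
begin

definition "scaleR r x = Dual (r * re x) (r * du x)"

instance
  by standard (simp_all add: dualnum_eq_iff scaleR_dualnum_def algebra_simps)

end

lemma re_du_scaleR [simp]:
  "re (r *\<^sub>R x) = r * re x" "du (r *\<^sub>R x) = r * du x"
  by (simp_all add: scaleR_dualnum_def)

lemma re_du_numeral [simp]:
  "re (numeral w) = numeral w" "du (numeral w) = 0"
proof -
  have "(numeral w :: dualnum) = numeral w *\<^sub>R 1"
    by (metis of_real_def of_real_numeral)
  then show "re (numeral w) = numeral w" "du (numeral w) = 0"
    by (metis mult.right_neutral re_du_simps(3) re_du_scaleR(1),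
        metis mult_zero_right re_du_simps(4) re_du_scaleR(2))
qed

text \<open>
  The norm only serves to make limits and derivatives available. It induces the topology of
  \<open>\<real>\<times>\<real>\<close>, so both are taken in the real and in the dual part separately. The sum of
  absolute values is chosen because it is submultiplicative.
\<close>

instantiation dualnum :: real_normed_algebra_1
begin

definition "norm x = \<bar>re x\<bar> + \<bar>du x\<bar>"
definition sgn_dualnum_def: "sgn x = x /\<^sub>R norm (x :: dualnum)"
definition dist_dualnum_def: "dist x y = norm (x - y :: dualnum)"
definition uniformity_dualnum_def [code del]:
  "(uniformity :: (dualnum \<times> dualnum) filter) = (INF e\<in>{0 <..}. principal {(x, y). dist x y < e})"
definition open_dualnum_def [code del]:
  "open (U :: dualnum set) \<longleftrightarrow> (\<forall>x\<in>U. eventually (\<lambda>(x', y). x' = x \<longrightarrow> y \<in> U) uniformity)"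

instance
proof
  fix r s :: real and x y :: dualnum
  show "norm (x * y) \<le> norm x * norm y"
  proof -
    have "\<bar>re x * du y + du x * re y\<bar> \<le> \<bar>re x\<bar> * \<bar>du y\<bar> + \<bar>du x\<bar> * \<bar>re y\<bar>"
      by (metis abs_mult abs_triangle_ineq)
    then have "norm (x * y) \<le> \<bar>re x\<bar> * \<bar>re y\<bar> + (\<bar>re x\<bar> * \<bar>du y\<bar> + \<bar>du x\<bar> * \<bar>re y\<bar>)"
      by (simp add: norm_dualnum_def abs_mult)
    also have "\<dots> \<le> \<dots> + \<bar>du x\<bar> * \<bar>du y\<bar>" by simp
    also have "\<dots> = norm x * norm y"
      unfolding norm_dualnum_def by (simp only: distrib_left distrib_right ac_simps)
    finally show ?thesis .
  qed
  show "norm (x + y) \<le> norm x + norm y"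
    unfolding norm_dualnum_def by simp
  show "norm (scaleR r x) = \<bar>r\<bar> * norm x"
    by (simp add: norm_dualnum_def scaleR_dualnum_def abs_mult algebra_simps)
  show "(norm x = 0) = (x = 0)"
    by (simp add: norm_dualnum_def dualnum_eq_iff add_nonneg_eq_0_iff)
  show "norm (1 :: dualnum) = 1"
    by (simp add: norm_dualnum_def)
qed (rule sgn_dualnum_def dist_dualnum_def open_dualnum_def uniformity_dualnum_def)+

end

definition dual_unit :: dualnum where
  "dual_unit = Dual 0 1"

lemma dual_unit_square: "dual_unit\<^sup>2 = 0"
  by (simp add: dual_unit_def power2_eq_square dualnum_eq_iff)

lemma Dual_conv: "Dual a b = of_real a + dual_unit * of_real b"
  by (simp add: dual_unit_def dualnum_eq_iff of_real_def scaleR_dualnum_def)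


section \<open>The Lorentzian inner product\<close>

definition lorentz_inner :: "dualnum ^ 3 \<Rightarrow> dualnum ^ 3 \<Rightarrow> dualnum" where
  "lorentz_inner x y = x $ 1 * y $ 1 + x $ 2 * y $ 2 - x $ 3 * y $ 3"

definition lorentz_sign :: "dualnum ^ 3 ^ 3" where
  "lorentz_sign = vector [vector [1, 0, 0], vector [0, 1, 0], vector [0, 0, -1]]"

definition lorentz_antisymmetric :: "dualnum ^ 3 ^ 3 \<Rightarrow> bool" where
  "lorentz_antisymmetric A \<longleftrightarrow> A = - (lorentz_sign ** transpose A ** lorentz_sign)"

lemma lorentz_antisymmetric_iff_inner:
  "lorentz_antisymmetric A \<longleftrightarrow>
     (\<forall>x y. lorentz_inner (A *v x) y = - lorentz_inner x (A *v y))"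
proof -
  have z: "x = - x \<longleftrightarrow> x = 0" for x :: dualnum
    by (auto simp: dualnum_eq_iff)
  have z2: "2 * x = 0 \<longleftrightarrow> x = 0" for x :: dualnum
    by (simp add: dualnum_eq_iff)
  have entries: "lorentz_antisymmetric A \<longleftrightarrow>
      A $ 1 $ 1 = 0 \<and> A $ 2 $ 2 = 0 \<and> A $ 3 $ 3 = 0 \<and>
      A $ 2 $ 1 = - A $ 1 $ 2 \<and> A $ 3 $ 1 = A $ 1 $ 3 \<and> A $ 3 $ 2 = A $ 2 $ 3"
    unfolding lorentz_antisymmetric_def vec_eq_iff forall_3
    by (simp add: matrix_matrix_mult_def transpose_def lorentz_sign_def sum_3 z)
      (metis minus_equation_iff)
  show ?thesis
  proof
    assume "lorentz_antisymmetric A"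
    then show "\<forall>x y. lorentz_inner (A *v x) y = - lorentz_inner x (A *v y)"
      unfolding entries
      by (simp add: lorentz_inner_def matrix_vector_mult_def sum_3 algebra_simps)
  next
    assume *: "\<forall>x y. lorentz_inner (A *v x) y = - lorentz_inner x (A *v y)"
    have c: "(A *v axis j 1) $ i = A $ i $ j" for i j
      by (simp add: matrix_vector_mult_def axis_def if_distrib cong: if_cong)
    have eq: "lorentz_inner (A *v axis j 1) (axis i 1)
        = - lorentz_inner (axis j 1) (A *v axis i 1)" for i j
      using * by blast
    show "lorentz_antisymmetric A"
      unfolding entries
      using eq[of 1 1] eq[of 2 2] eq[of 3 3] eq[of 1 2] eq[of 1 3] eq[of 2 3]
      unfolding lorentz_inner_def c by (simp add: axis_def z z2)
  qed
qed


section \<open>Matrix powers and iterated derivatives\<close>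

text \<open>
  The library's \<open>M ^ k\<close> and \<open>exp\<close> are not usable for matrices of type \<open>_ ^ 'n ^ 'n\<close>, whose
  \<open>*\<close> is the entrywise product.
\<close>

primrec matpow :: "'a::semiring_1 ^ 'n ^ 'n \<Rightarrow> nat \<Rightarrow> 'a ^ 'n ^ 'n" where
  "matpow M 0 = mat 1"
| "matpow M (Suc k) = M ** matpow M k"

definition nderiv :: "nat \<Rightarrow> (real \<Rightarrow> 'a::real_normed_vector) \<Rightarrow> real \<Rightarrow> 'a" where
  "nderiv k f = ((\<lambda>f t. vector_derivative f (at t)) ^^ k) f"

definition smooth :: "(real \<Rightarrow> 'a::real_normed_vector) \<Rightarrow> bool" where
  "smooth f \<longleftrightarrow> (\<forall>k t. nderiv k f differentiable (at t))"

end

(* Both summands of Y are smooth and matrix-vector multiplication is a bounded bilinear map, so the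
   first formula is the general Leibniz rule. The second applies the Leibniz rule once more, to
   H = h g, using g^(i) = A^i g: the exponential series may be differentiated termwise because the
   differentiated series converges uniformly on bounded intervals. *)

theory Submission
  imports Defs
begin

text \<open>The comparison test that sums the exponential series needs a complete space. The norm
  dominates the real and the dual part, so both inherit the Cauchy property.\<close>

instance dualnum :: banach
proof
  fix X :: "nat \<Rightarrow> dualnum"
  assume X: "Cauchy X"
  have "bounded_linear re" "bounded_linear du"
    by (rule bounded_linear_intro[where K = 1]; simp add: norm_dualnum_def)+
  then have "convergent (\<lambda>n. re (X n))" "convergent (\<lambda>n. du (X n))"
    using X bounded_linear.Cauchy Cauchy_convergent_iff by blast+
  then obtain a b where "(\<lambda>n. re (X n)) \<longlonglongrightarrow> a" "(\<lambda>n. du (X n)) \<longlonglongrightarrow> b"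
    by (auto simp: convergent_def)
  then have "(\<lambda>n. of_real (re (X n)) + dual_unit * of_real (du (X n)))
      \<longlonglongrightarrow> of_real a + dual_unit * of_real b"
    by (intro tendsto_intros)
  then show "convergent X"
    unfolding convergent_def Dual_conv[symmetric] by auto
qed

section \<open>Iterated derivatives\<close>

lemma nderiv_0 [simp]: "nderiv 0 f = f"
  by (simp add: nderiv_def)

lemma nderiv_Suc: "nderiv (Suc k) f t = vector_derivative (nderiv k f) (at t)"
  by (simp add: nderiv_def)

lemma smooth_has_vector_derivative:
  "smooth f \<Longrightarrow> (nderiv k f has_vector_derivative nderiv (Suc k) f t) (at t)"
  by (simp add: nderiv_Suc smooth_def vector_derivative_works[symmetric])

text \<open>The induction on the order, done once: a closed formula for all derivatives only has to
  be guessed as a tower \<open>F\<close> and differentiated one step. Leibniz sums and the matrix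
  exponential are both treated this way.\<close>

lemma nderiv_eqI:
  assumes "F 0 = f"
    and "\<And>k t. (F k has_vector_derivative F (Suc k) t) (at t)"
  shows "nderiv k f = F k"
proof (induction k)
  case 0
  then show ?case by (simp add: assms)
next
  case (Suc k)
  then show ?case
    by (intro ext) (simp only: nderiv_Suc vector_derivative_at[OF assms(2)])
qed

lemma smoothI:
  assumes "F 0 = f"
    and "\<And>k t. (F k has_vector_derivative F (Suc k) t) (at t)"
  shows "smooth f"
  unfolding smooth_def nderiv_eqI[of F, OF assms]
  using assms(2) differentiableI_vector by blast

lemma nderiv_add:
  assumes "smooth f" "smooth g"
  shows "nderiv k (\<lambda>t. f t + g t) = (\<lambda>t. nderiv k f t + nderiv k g t)"
  by (rule nderiv_eqI[where F = "\<lambda>k t. nderiv k f t + nderiv k g t"])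
    (auto intro!: derivative_eq_intros smooth_has_vector_derivative assms)

text \<open>Pascal's rule in the form the Leibniz induction needs: with \<open>a p q\<close> the
  product of a p-th and a q-th derivative, the right-hand side is what the product rule makes of the
  sum of order \<open>n\<close>.\<close>

lemma sum_binomial_Suc:
  fixes a :: "nat \<Rightarrow> nat \<Rightarrow> 'a::real_vector"
  shows "(\<Sum>k=0..Suc n. real (Suc n choose k) *\<^sub>R a (Suc n - k) k) =
    (\<Sum>k=0..n. real (n choose k) *\<^sub>R (a (n - k) (Suc k) + a (Suc (n - k)) k))"
proof -
  have "(\<Sum>k\<le>Suc n. real (Suc n choose k) *\<^sub>R a (Suc n - k) k) =
      a (Suc n) 0 + (\<Sum>k\<le>n. real (n choose Suc k) *\<^sub>R a (n - k) (Suc k))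
        + (\<Sum>k\<le>n. real (n choose k) *\<^sub>R a (n - k) (Suc k))"
    by (simp add: sum.atMost_Suc_shift scaleR_add_left sum.distrib del: sum.atMost_Suc)
  \<comment> \<open>The term split off before is the index 0 of the reindexed sum.\<close>
  also have "a (Suc n) 0 + (\<Sum>k\<le>n. real (n choose Suc k) *\<^sub>R a (n - k) (Suc k)) =
      (\<Sum>k\<le>Suc n. real (n choose k) *\<^sub>R a (Suc n - k) k)"
    by (simp add: sum.atMost_Suc_shift del: sum.atMost_Suc)
  \<comment> \<open>The top index contributes nothing, since \<open>n choose Suc n\<close> is 0;
    below it \<open>Suc n - k\<close> equals \<open>Suc (n - k)\<close>.\<close>
  also have "\<dots> = (\<Sum>k\<le>n. real (n choose k) *\<^sub>R a (Suc (n - k)) k)"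
    by (simp add: Suc_diff_le)
  finally show ?thesis
    by (simp add: atLeast0AtMost scaleR_add_right sum.distrib add.commute del: sum.atMost_Suc)
qed

context bounded_bilinear
begin

text \<open>Kept for a general bounded bilinear map, because it serves both \<open>*v\<close> and
  the product of a scalar function with a matrix.\<close>

lemma leibniz_step:
  assumes "smooth f" "smooth g"
  shows "((\<lambda>t. \<Sum>i=0..k. real (k choose i) *\<^sub>R prod (nderiv (k - i) f t) (nderiv i g t))
    has_vector_derivative
      (\<Sum>i=0..Suc k. real (Suc k choose i) *\<^sub>R prod (nderiv (Suc k - i) f t) (nderiv i g t))) (at t)"
  unfolding sum_binomial_Suc[of k "\<lambda>p q. prod (nderiv p f t) (nderiv q g t)"]
  by (intro has_vector_derivative_sum
      bounded_linear.has_vector_derivative[OF bounded_linear_scaleR_right]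
      has_vector_derivative smooth_has_vector_derivative assms)

lemma nderiv_prod:
  assumes "smooth f" "smooth g"
  shows "nderiv k (\<lambda>t. prod (f t) (g t)) t =
    (\<Sum>i=0..k. real (k choose i) *\<^sub>R prod (nderiv (k - i) f t) (nderiv i g t))"
  by (subst nderiv_eqI[where F = "\<lambda>k t. \<Sum>i=0..k. real (k choose i) *\<^sub>R prod (nderiv (k - i) f t) (nderiv i g t)",
      OF _ leibniz_step[OF assms]]) simp_all

lemma smooth_prod:
  assumes "smooth f" "smooth g"
  shows "smooth (\<lambda>t. prod (f t) (g t))"
  by (rule smoothI[where F = "\<lambda>k t. \<Sum>i=0..k. real (k choose i) *\<^sub>R prod (nderiv (k - i) f t) (nderiv i g t)",
      OF _ leibniz_step[OF assms]]) simp

end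

section \<open>Bounded bilinear matrix products\<close>

lemma norm_vec_le_sum: "norm x \<le> (\<Sum>i\<in>UNIV. norm (x $ i))"
  unfolding norm_vec_def by (rule L2_set_le_sum) simp

lemma norm_entry_le: "norm (M $ i $ j) \<le> norm M"
  by (rule order_trans[OF Finite_Cartesian_Product.norm_nth_le Finite_Cartesian_Product.norm_nth_le])

text \<open>Each product of entries is at most \<open>norm M * norm x\<close>; the constant counts
  these products.\<close>

lemma bounded_bilinear_matrix_vector_mult:
  "bounded_bilinear ((*v) :: 'a::real_normed_algebra_1 ^ 'n ^ 'm \<Rightarrow> 'a ^ 'n \<Rightarrow> 'a ^ 'm)"
proof
  show "\<exists>K. \<forall>(M :: 'a ^ 'n ^ 'm) x. norm (M *v x) \<le> norm M * norm x * K"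
  proof (intro exI allI)
    fix M :: "'a ^ 'n ^ 'm" and x :: "'a ^ 'n"
    have "norm (M $ i $ j * x $ j) \<le> norm M * norm x" for i j
      by (intro order_trans[OF norm_mult_ineq] mult_mono norm_ge_zero norm_entry_le
          Finite_Cartesian_Product.norm_nth_le)
    then have "norm ((M *v x) $ i) \<le> (\<Sum>j\<in>(UNIV :: 'n set). norm M * norm x)" for i
      by (simp only: matrix_vector_mult_def vec_lambda_beta sum_norm_le)
    then have "norm (M *v x) \<le> (\<Sum>i\<in>(UNIV :: 'm set). \<Sum>j\<in>(UNIV :: 'n set). norm M * norm x)"
      by (intro order_trans[OF norm_vec_le_sum] sum_mono)
    then show "norm (M *v x) \<le> norm M * norm x * (CARD('m) * CARD('n))"
      by (simp add: mult_ac)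
  qed
qed (simp_all add: vec_eq_iff matrix_vector_mult_def algebra_simps sum.distrib scaleR_sum_right)

lemma bounded_bilinear_matrix_matrix_mult:
  "bounded_bilinear ((**) :: 'a::real_normed_algebra_1 ^ 'n ^ 'm \<Rightarrow> 'a ^ 'p ^ 'n \<Rightarrow> 'a ^ 'p ^ 'm)"
proof
  show "\<exists>K. \<forall>(M :: 'a ^ 'n ^ 'm) (N :: 'a ^ 'p ^ 'n). norm (M ** N) \<le> norm M * norm N * K"
  proof (intro exI allI)
    fix M :: "'a ^ 'n ^ 'm" and N :: "'a ^ 'p ^ 'n"
    have "norm (M $ i $ j * N $ j $ l) \<le> norm M * norm N" for i j l
      by (intro order_trans[OF norm_mult_ineq] mult_mono norm_ge_zero norm_entry_le)
    then have "norm ((M ** N) $ i $ l) \<le> (\<Sum>j\<in>(UNIV :: 'n set). norm M * norm N)" for i l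
      by (simp only: matrix_matrix_mult_def vec_lambda_beta sum_norm_le)
    then have "norm (M ** N) \<le>
        (\<Sum>i\<in>(UNIV :: 'm set). \<Sum>l\<in>(UNIV :: 'p set). \<Sum>j\<in>(UNIV :: 'n set). norm M * norm N)"
      by (intro order_trans[OF norm_vec_le_sum] sum_mono order_trans[OF norm_vec_le_sum])
    then show "norm (M ** N) \<le> norm M * norm N * (CARD('m) * CARD('p) * CARD('n))"
      by (simp add: mult_ac)
  qed
qed (simp_all add: vec_eq_iff matrix_matrix_mult_def algebra_simps sum.distrib scaleR_sum_right)

lemma bounded_linear_mat: "bounded_linear (mat :: 'a::real_normed_vector \<Rightarrow> 'a ^ 'n ^ 'n)"
proof
  show "\<exists>K. \<forall>x. norm (mat x :: 'a ^ 'n ^ 'n) \<le> norm x * K"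
  proof (intro exI allI)
    fix x :: 'a
    have "norm ((mat x :: 'a ^ 'n ^ 'n) $ i $ j) \<le> norm x" for i j
      by (simp add: mat_def)
    then have "norm (mat x :: 'a ^ 'n ^ 'n) \<le> (\<Sum>i\<in>(UNIV :: 'n set). \<Sum>j\<in>(UNIV :: 'n set). norm x)"
      by (intro order_trans[OF norm_vec_le_sum] sum_mono order_trans[OF norm_vec_le_sum])
    then show "norm (mat x :: 'a ^ 'n ^ 'n) \<le> norm x * (CARD('n) * CARD('n))"
      by (simp add: mult_ac)
  qed
qed (simp_all add: vec_eq_iff mat_def)

section \<open>The matrix exponential\<close>

text \<open>Differentiating \<open>matpow A k ** g t\<close> puts the new factor \<open>A\<close> to
  the right of the power, whereas \<open>matpow\<close> recurses on the left.\<close>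

lemma matpow_mult_commute: "M ** matpow M k = matpow M k ** M"
  by (induction k) (simp_all add: matrix_mul_assoc)

lemma matpow_norm_bound:
  fixes M :: "'a::real_normed_algebra_1 ^ 'n ^ 'n"
  shows "\<exists>c K. \<forall>k. norm (matpow M k) \<le> c * K ^ k"
proof -
  obtain B where B: "B > 0" "\<And>(P :: 'a ^ 'n ^ 'n) (Q :: 'a ^ 'n ^ 'n). norm (P ** Q) \<le> norm P * norm Q * B"
    using bounded_bilinear.pos_bounded[OF bounded_bilinear_matrix_matrix_mult] by blast
  \<comment> \<open>The norm bound for products carries a factor \<open>B\<close>, which is absorbed
    into the ratio of the geometric bound.\<close>
  define K where "K = norm M * B"
  have "norm (matpow M k) \<le> norm (mat 1 :: 'a ^ 'n ^ 'n) * K ^ k" for k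
  proof (induction k)
    case (Suc k)
    have "norm (matpow M (Suc k)) \<le> (norm M * B) * norm (matpow M k)"
      using B(2)[of M "matpow M k"] by (simp add: mult_ac)
    also have "\<dots> \<le> K * (norm (mat 1 :: 'a ^ 'n ^ 'n) * K ^ k)"
      using Suc B(1) by (intro mult_mono) (auto simp: K_def)
    finally show ?case by (simp add: mult_ac)
  qed simp
  then show ?thesis by (intro exI allI)
qed

lemma summable_matexp:
  fixes M :: "'a::{real_normed_algebra_1, banach} ^ 'n ^ 'n"
  shows "summable (\<lambda>k. (t ^ k / fact k) *\<^sub>R matpow M k)"
proof -
  obtain c K where K: "\<forall>k. norm (matpow M k) \<le> c * K ^ k"
    using matpow_norm_bound[of M] by (elim exE)
  \<comment> \<open>The majorant is \<open>c\<close> times the real exponential series at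
    \<open>\<bar>t\<bar> * K\<close>.\<close>
  have "summable (\<lambda>k. c * (inverse (fact k) * (\<bar>t\<bar> * K) ^ k))"
    by (intro summable_mult summable_exp)
  moreover have "norm ((t ^ k / fact k) *\<^sub>R matpow M k) \<le> c * (inverse (fact k) * (\<bar>t\<bar> * K) ^ k)" for k
    using mult_left_mono[OF K[rule_format, of k], of "\<bar>t\<bar> ^ k / fact k"]
    by (simp add: power_mult_distrib power_abs divide_simps mult_ac)
  ultimately show ?thesis
    by (rule summable_comparison_test'[where N = 0])
qed

lemma has_vector_derivative_matexp:
  fixes M :: "'a::{real_normed_algebra_1, banach} ^ 'n ^ 'n"
  shows "((\<lambda>t. \<Sum>k. (t ^ k / fact k) *\<^sub>R matpow M k) has_vector_derivative
      M ** (\<Sum>k. (t ^ k / fact k) *\<^sub>R matpow M k)) (at t)"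
proof -
  \<comment> \<open>\<open>d k\<close> is the derivative of the k-th term; the factor
    \<open>real k\<close> makes \<open>d 0\<close> vanish despite the truncated
    \<open>0 - 1\<close>.\<close>
  define d where "d k s = (real k * s ^ (k - 1) / fact k) *\<^sub>R matpow M k" for k and s :: real
  \<comment> \<open>Any radius beyond \<open>\<bar>t\<bar>\<close> would do: \<open>t\<close> must
    lie in an open ball on which the derived series has a numerical majorant.\<close>
  define R where "R = \<bar>t\<bar> + 1"
  define S where "S = ball (0 :: real) R"
  have t: "t \<in> S"
    by (simp add: S_def R_def)
  obtain c K where K: "\<forall>k. norm (matpow M k) \<le> c * K ^ k"
    using matpow_norm_bound[of M] by (elim exE)
  define b where "b k = (real k * R ^ (k - 1) / fact k) * (c * K ^ k)" for k
  \<comment> \<open>Shifted by one index, the majorant is a multiple of the exponential series at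
    \<open>R * K\<close>.\<close>
  have "b (Suc k) = c * K * (inverse (fact k) * (R * K) ^ k)" for k
    by (simp add: b_def power_mult_distrib field_simps del: of_nat_Suc)
  then have "summable (\<lambda>k. b (Suc k))"
    by (simp only: summable_mult summable_exp)
  then have "summable b"
    by (simp only: summable_Suc_iff)
  moreover have "norm (d k s) \<le> b k" if "s \<in> S" for k s
  proof -
    have "\<bar>s\<bar> ^ (k - 1) \<le> R ^ (k - 1)"
      using that by (intro power_mono) (auto simp: S_def)
    then have "real k * \<bar>s\<bar> ^ (k - 1) / fact k \<le> real k * R ^ (k - 1) / fact k"
      by (intro divide_right_mono mult_left_mono) auto
    then show ?thesis
      unfolding d_def b_def norm_scaleR
      by (intro mult_mono K[rule_format]) (auto simp: abs_mult power_abs R_def)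
  qed
  ultimately have unif: "uniform_limit S (\<lambda>n s. \<Sum>k<n. d k s) (\<lambda>s. \<Sum>k. d k s) sequentially"
    by (intro Weierstrass_m_test)
  have "\<exists>G. \<forall>s\<in>S. (\<lambda>k. (s ^ k / fact k) *\<^sub>R matpow M k) sums G s \<and>
      (G has_derivative (\<lambda>x. x *\<^sub>R (\<Sum>k. d k s))) (at s within S)"
  proof (rule has_derivative_series)
    show "convex S" "t \<in> S"
      using t by (simp_all add: S_def)
    show "((\<lambda>s. (s ^ k / fact k) *\<^sub>R matpow M k) has_derivative (\<lambda>x. x *\<^sub>R d k s)) (at s within S)"
      for k s
      by (auto intro!: derivative_eq_intros simp: d_def fun_eq_iff)
    show "(\<lambda>k. (t ^ k / fact k) *\<^sub>R matpow M k) sums (\<Sum>k. (t ^ k / fact k) *\<^sub>R matpow M k)"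
      by (rule summable_sums[OF summable_matexp])
    fix e :: real
    assume "e > 0"
    with unif have "\<forall>\<^sub>F n in sequentially. \<forall>s\<in>S. dist (\<Sum>k<n. d k s) (\<Sum>k. d k s) < e"
      by (simp add: uniform_limit_iff)
    \<comment> \<open>Termwise differentiation asks for closeness of the derivatives as linear maps
      in \<open>x\<close>; the uniform estimate is scaled by \<open>norm x\<close>.\<close>
    then show "\<forall>\<^sub>F n in sequentially. \<forall>s\<in>S. \<forall>x :: real.
        norm ((\<Sum>k<n. x *\<^sub>R d k s) - x *\<^sub>R (\<Sum>k. d k s)) \<le> e * norm x"
    proof (eventually_elim, intro ballI allI)
      fix n and s x :: real
      assume "\<forall>s\<in>S. dist (\<Sum>k<n. d k s) (\<Sum>k. d k s) < e" "s \<in> S"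
      then have "norm ((\<Sum>k<n. d k s) - (\<Sum>k. d k s)) * norm x \<le> e * norm x"
        by (intro mult_right_mono) (auto simp: dist_norm less_imp_le)
      then show "norm ((\<Sum>k<n. x *\<^sub>R d k s) - x *\<^sub>R (\<Sum>k. d k s)) \<le> e * norm x"
        by (simp flip: scaleR_sum_right scaleR_diff_right add: mult.commute)
    qed
  qed
  then obtain G where G: "\<And>s. s \<in> S \<Longrightarrow> (\<lambda>k. (s ^ k / fact k) *\<^sub>R matpow M k) sums G s"
    "(G has_vector_derivative (\<Sum>k. d k t)) (at t within S)"
    using t by (auto simp: has_vector_derivative_def)
  have "((\<lambda>t. \<Sum>k. (t ^ k / fact k) *\<^sub>R matpow M k) has_vector_derivative (\<Sum>k. d k t)) (at t within S)"
    by (rule has_vector_derivative_transform[OF t _ G(2)]) (rule sums_unique[OF G(1), symmetric])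
  moreover have "at t within S = at t"
    using t by (intro at_within_open) (simp_all add: S_def)
  \<comment> \<open>Left multiplication by \<open>M\<close> passes through the sum and turns the
    k-th term into the derived term of index \<open>Suc k\<close>. As \<open>d 0\<close> is zero,
    undoing the shift adds nothing.\<close>
  moreover have "(\<lambda>k. d (Suc k) t) sums (M ** (\<Sum>k. (t ^ k / fact k) *\<^sub>R matpow M k))"
  proof -
    have "(\<lambda>k. M ** ((t ^ k / fact k) *\<^sub>R matpow M k)) sums (M ** (\<Sum>k. (t ^ k / fact k) *\<^sub>R matpow M k))"
      by (intro bounded_linear.sums[OF bounded_bilinear.bounded_linear_right
            [OF bounded_bilinear_matrix_matrix_mult]] summable_sums summable_matexp)
    moreover have "d (Suc k) t = M ** ((t ^ k / fact k) *\<^sub>R matpow M k)" for k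
      by (simp add: d_def bounded_bilinear.scaleR_right[OF bounded_bilinear_matrix_matrix_mult]
          del: of_nat_Suc)
    ultimately show ?thesis
      by simp
  qed
  then have "(\<Sum>k. d k t) = M ** (\<Sum>k. (t ^ k / fact k) *\<^sub>R matpow M k)"
    by (subst (asm) sums_Suc_iff) (simp add: d_def sums_iff)
  ultimately show ?thesis
    by simp
qed

section \<open>Higher derivatives of the homothetic exponential motion\<close>

theorem theorem3:
  fixes A :: "dualnum ^ 3 ^ 3"
    and h :: "real \<Rightarrow> dualnum"
    and g H :: "real \<Rightarrow> dualnum ^ 3 ^ 3"
    and X C Y :: "real \<Rightarrow> dualnum ^ 3"
    and n :: nat
  assumes A: "lorentz_antisymmetric A"
    and g: "\<And>t. g t = (\<Sum>k. (t ^ k / fact k) *\<^sub>R matpow A k)"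
    and h: "smooth h" "\<not> h constant_on UNIV" "\<And>t. h t dvd 1"
    and H: "\<And>t. H t = mat (h t) ** g t"
    and C: "smooth C" "nderiv 1 C \<noteq> (\<lambda>t. 0)"
    and X: "smooth X"
    and Y: "\<And>t. Y t = H t *v X t + C t"
    and n: "n \<ge> 1" "nderiv n C \<noteq> (\<lambda>t. 0)"
  shows "(\<forall>t. nderiv n Y t =
           (\<Sum>k=0..n. real (n choose k) *\<^sub>R (nderiv (n - k) H t *v nderiv k X t))
             + nderiv n C t)
       \<and> (\<forall>t. nderiv n Y t =
           (\<Sum>k=0..n. real (n choose k) *\<^sub>R
              (((\<Sum>i=0..n-k. real ((n - k) choose i) *\<^sub>R
                   (mat (nderiv (n - k - i) h t) ** matpow A i)) ** g t) *v nderiv k X t))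
             + nderiv n C t)"
proof -
  interpret mm: bounded_bilinear "(**) :: dualnum ^ 3 ^ 3 \<Rightarrow> dualnum ^ 3 ^ 3 \<Rightarrow> dualnum ^ 3 ^ 3"
    by (rule bounded_bilinear_matrix_matrix_mult)
  interpret mv: bounded_bilinear "(*v) :: dualnum ^ 3 ^ 3 \<Rightarrow> dualnum ^ 3 \<Rightarrow> dualnum ^ 3"
    by (rule bounded_bilinear_matrix_vector_mult)
  \<comment> \<open>Precomposing the matrix product with the linear map \<open>mat\<close> makes the
    Leibniz rule available for \<open>h\<close> and \<open>g\<close>.\<close>
  interpret hg: bounded_bilinear "\<lambda>c (P :: dualnum ^ 3 ^ 3). mat c ** P"
    using bounded_bilinear.comp[OF mm.bounded_bilinear_axioms bounded_linear_mat bounded_linear_ident] .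
  have g': "(g has_vector_derivative A ** g t) (at t)" for t
    using has_vector_derivative_matexp[of A t] by (simp add: g[abs_def])
  \<comment> \<open>The constant \<open>matpow A k\<close> passes through the derivative, and the
    factor \<open>A\<close> coming from \<open>g\<close> raises the power by one.\<close>
  have tower: "((\<lambda>t. matpow A k ** g t) has_vector_derivative matpow A (Suc k) ** g t) (at t)" for k t
    using bounded_linear.has_vector_derivative[OF mm.bounded_linear_right g', of "matpow A k"]
    by (simp add: matrix_mul_assoc matpow_mult_commute)
  have g_smooth: "smooth g" and g_nderiv: "nderiv k g t = matpow A k ** g t" for k t
    using smoothI[where F = "\<lambda>k t. matpow A k ** g t", OF _ tower, of g]
      nderiv_eqI[where F = "\<lambda>k t. matpow A k ** g t", OF _ tower, of g]
    by simp_all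
  have H_eq: "H = (\<lambda>t. mat (h t) ** g t)" and Y_eq: "Y = (\<lambda>t. H t *v X t + C t)"
    using H Y by auto
  have H_smooth: "smooth H"
    unfolding H_eq by (intro hg.smooth_prod h g_smooth)
  \<comment> \<open>Every Leibniz term ends in \<open>matpow A i ** g t\<close>, so
    \<open>g t\<close> factors out on the right.\<close>
  have H_nderiv: "nderiv m H t =
      (\<Sum>i=0..m. real (m choose i) *\<^sub>R (mat (nderiv (m - i) h t) ** matpow A i)) ** g t" for m t
    unfolding H_eq hg.nderiv_prod[OF h(1) g_smooth]
    by (simp add: g_nderiv mm.sum_left mm.scaleR_left matrix_mul_assoc)
  have "nderiv n Y t =
      (\<Sum>k=0..n. real (n choose k) *\<^sub>R (nderiv (n - k) H t *v nderiv k X t)) + nderiv n C t" for t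
    unfolding Y_eq nderiv_add[OF mv.smooth_prod[OF H_smooth X] C(1)] mv.nderiv_prod[OF H_smooth X] ..
  then show ?thesis
    by (simp add: H_nderiv)
qed

end
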